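(* Let $\eta>0$, and let $M$, $K$, $m$ be the mass matrix, stiffness matrix and mean-value vector of the piecewise linear finite element space described in the context, with $\bar K=K+mm^T$. Let $$\mathcal{A}=\begin{pmatrix}\bar K & M\\ M & -\eta\bar K\end{pmatrix},\qquad \mathcal{B}_{\mathrm{bdsc}}=\begin{pmatrix}\bar K & 0\\ 0 & S_{\mathrm{pre}}\end{pmatrix},\qquad S_{\mathrm{pre}}=\eta(\bar K+\eta^{-1/2}M)\,\bar K^{-1}\,(\bar K+\eta^{-1/2}M).$$ Then $$\kappa(\mathcal{B}_{\mathrm{bdsc}}^{-1}\mathcal{A})<\frac{\sqrt5+1}{2(\sqrt2-1)}\approx 3.90.$$
   Context: Let $\Omega=(0,1)\times(0,1)$, let $\mathcal{T}_h$ be a triangulation of $\Omega$ with node set $\mathcal{N}_h$, $n=|\mathcal{N}_h|$, and let $(\lambda_p)_{p\in\mathcal{N}_h}$ be the nodal basis of the space of continuous functions on $\bar\Omega$ that are linear on each triangle (no boundary conditions imposed). The mass matrix is $M=(\int_\Omega \lambda_p\lambda_q\,dx)_{p,q}$, the stiffness matrix is $K=(\int_\Omega \nabla\lambda_p\cdot\nabla\lambda_q\,dx)_{p,q}$, and $m=(\int_\Omega\lambda_p\,dx)_p\in\mathbb{R}^n$. The parameter is $\eta=\epsilon\tau>0$. For a nonsingular matrix $Z$ with real eigenvalues (possibly negative), the condition number is $\kappa(Z)=\max|\lambda(Z)|/\min|\lambda(Z)|$, the maximum and minimum being over all eigenvalues $\lambda(Z)$ of $Z$. *)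

theory Defs
  imports "HOL-Analysis.Analysis"
begin

definition unit_square :: "(real \<times> real) set" where
  "unit_square = {0<..<1} \<times> {0<..<1}"

text \<open>The library's \<open>triangulation\<close> demands a finite set of simplices, any two of
  which meet in a common face (possibly empty), so the mesh is conforming (no hanging nodes).\<close>

definition is_mesh :: "(real \<times> real) set set \<Rightarrow> bool" where
  "is_mesh \<T> \<longleftrightarrow>
     triangulation \<T> \<and> (\<forall>T\<in>\<T>. 2 simplex T) \<and> \<Union>\<T> = closure unit_square"

definition mesh_nodes :: "(real \<times> real) set set \<Rightarrow> (real \<times> real) set" where
  "mesh_nodes \<T> = {p. \<exists>T\<in>\<T>. p extreme_point_of T}"

text \<open>Functions are total on the plane; their values outside the closed square are
  unconstrained and never used.\<close>

definition P1_space :: "(real \<times> real) set set \<Rightarrow> (real \<times> real \<Rightarrow> real) set" where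
  "P1_space \<T> = {v. continuous_on (closure unit_square) v \<and>
     (\<forall>T\<in>\<T>. \<exists>a b. \<forall>z\<in>T. v z = a \<bullet> z + b)}"

text \<open>The nodes are numbered by a finite type \<open>'n\<close> through \<open>x\<close>, so that matrices and vectors
  indexed by nodes become library matrices and vectors of dimension \<open>CARD('n)\<close>.\<close>

definition node_numbering :: "(real \<times> real) set set \<Rightarrow> ('n::finite \<Rightarrow> real \<times> real) \<Rightarrow> bool" where
  "node_numbering \<T> x \<longleftrightarrow> bij_betw x UNIV (mesh_nodes \<T>)"

definition nodal_basis ::
  "(real \<times> real) set set \<Rightarrow> ('n::finite \<Rightarrow> real \<times> real) \<Rightarrow> ('n \<Rightarrow> real \<times> real \<Rightarrow> real) \<Rightarrow> bool" where
  "nodal_basis \<T> x \<phi> \<longleftrightarrow>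
     (\<forall>p. \<phi> p \<in> P1_space \<T>) \<and> (\<forall>p q. \<phi> p (x q) = (if p = q then 1 else 0))"

text \<open>The classical gradient. A function in the space above has one in the interior of
  each triangle, hence almost everywhere in the square, where it agrees with the weak gradient;
  the arbitrary value elsewhere does not affect integrals.\<close>

definition grad :: "('a::real_inner \<Rightarrow> real) \<Rightarrow> 'a \<Rightarrow> 'a" where
  "grad f z = (THE D. GDERIV f z :> D)"

definition mass_matrix :: "('n::finite \<Rightarrow> real \<times> real \<Rightarrow> real) \<Rightarrow> real^'n^'n" where
  "mass_matrix \<phi> = (\<chi> p q. LINT z:unit_square|lebesgue. \<phi> p z * \<phi> q z)"

definition stiffness_matrix :: "('n::finite \<Rightarrow> real \<times> real \<Rightarrow> real) \<Rightarrow> real^'n^'n" where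
  "stiffness_matrix \<phi> = (\<chi> p q. LINT z:unit_square|lebesgue. grad (\<phi> p) z \<bullet> grad (\<phi> q) z)"

definition mean_vector :: "('n::finite \<Rightarrow> real \<times> real \<Rightarrow> real) \<Rightarrow> real^'n" where
  "mean_vector \<phi> = (\<chi> p. LINT z:unit_square|lebesgue. \<phi> p z)"

definition block_matrix ::
  "'a^'n^'n \<Rightarrow> 'a^'m^'n \<Rightarrow> 'a^'n^'m \<Rightarrow> 'a^'m^'m \<Rightarrow> 'a^('n + 'm)^('n + 'm)" where
  "block_matrix A B C D = (\<chi> i j. case i of
       Inl p \<Rightarrow> (case j of Inl q \<Rightarrow> A $ p $ q | Inr q \<Rightarrow> B $ p $ q)
     | Inr p \<Rightarrow> (case j of Inl q \<Rightarrow> C $ p $ q | Inr q \<Rightarrow> D $ p $ q))"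

definition eigenvalues :: "real^'n^'n \<Rightarrow> complex set" where
  "eigenvalues Z =
     {\<mu>. \<exists>v. v \<noteq> 0 \<and> map_matrix complex_of_real Z *v v = \<mu> *s v}"

text \<open>Meaningful for invertible \<open>Z\<close> only: for singular \<open>Z\<close> the denominator vanishes and
  the value is \<open>0\<close>.\<close>

definition cond_number :: "real^'n^'n \<Rightarrow> real" where
  "cond_number Z = Max (cmod ` eigenvalues Z) / Min (cmod ` eigenvalues Z)"

end

theory Submission
  imports Defs
begin

text \<open>The matrices \<open>Kbar\<close> and \<open>M\<close> are symmetric positive definite, and the estimate follows
  from this. For \<open>M\<close> it holds because a finite element function with vanishing \<open>L\<^sup>2\<close> norm vanishes,
  and so do its nodal values. If \<open>v \<bullet> (Kbar *v v) = 0\<close>, the finite element function with nodal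
  values \<open>v\<close> has gradient zero on every triangle; being continuous on a connected square and taking
  finitely many values it is constant, and the rank one term says that its mean is zero.

  Let \<open>(u, w) \<noteq> 0\<close> satisfy \<open>A (u, w) = \<mu> Bbdsc (u, w)\<close> and put \<open>y = Kbar\<^sup>-\<^sup>1 M w\<close>. The first block row
  says \<open>y = (\<mu> - 1) u\<close>. Pairing the second with \<open>(\<mu> - 1) w\<close> eliminates \<open>u\<close> and leaves
  \<open>\<mu>\<^sup>2 (k + 2 m + n) - \<mu> (2 m + n) - (k + n) = 0\<close> with the scalars
  \<open>k = \<eta> (w \<bullet> (Kbar *v w))\<close>, \<open>m = \<surd>\<eta> (w \<bullet> (M *v w))\<close> and \<open>n = y \<bullet> (Kbar *v y)\<close>. As \<open>k\<close>, \<open>m > 0\<close> and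
  \<open>n \<ge> 0\<close>, the polynomial is positive at plus and minus the golden ratio. Since \<open>m = \<surd>\<eta> (w \<bullet> (Kbar *v y))\<close>,
  the Cauchy-Schwarz inequality in the energy product gives \<open>2 \<surd>2 m \<le> n + 2 k\<close>, and then the
  polynomial is at most \<open>0\<close> at plus and minus \<open>\<surd>2 - 1\<close>. Hence
  \<open>\<surd>2 - 1 \<le> \<bar>\<mu>\<bar> < (\<surd>5 + 1) / 2\<close> (lemma \<open>preconditioned_eigenvalue_bounds\<close>), which gives the
  bound on the quotient.

  It remains to know that the spectrum is real, and that it is nonempty and finite, so that its
  maximum and minimum modulus are meaningful. These are general facts on \<open>B\<^sup>-\<^sup>1 A\<close> with \<open>A\<close> symmetric
  and \<open>B\<close> symmetric positive definite.\<close>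

section \<open>Symmetric positive definite matrices\<close>

definition spd :: "real^'n^'n \<Rightarrow> bool" where
  "spd B \<longleftrightarrow> transpose B = B \<and> (\<forall>x. x \<noteq> 0 \<longrightarrow> 0 < x \<bullet> (B *v x))"

lemma symmetric_matrix_swap:
  fixes A :: "real^'n^'n"
  assumes "transpose A = A"
  shows "x \<bullet> (A *v y) = y \<bullet> (A *v x)"
  by (metis assms dot_lmul_matrix inner_commute transpose_matrix_vector)

lemma spd_nonneg: "spd B \<Longrightarrow> 0 \<le> x \<bullet> (B *v x)"
  by (cases "x = 0") (auto simp: spd_def less_imp_le)

lemma spd_swap: "spd B \<Longrightarrow> x \<bullet> (B *v y) = y \<bullet> (B *v x)"
  unfolding spd_def using symmetric_matrix_swap by blast

lemma invertible_if_trivial_kernel: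
  fixes B :: "real^'n^'n"
  assumes "\<And>x. B *v x = 0 \<Longrightarrow> x = 0"
  shows "invertible B"
  using assms matrix_left_invertible_ker[of B] by (auto simp: invertible_left_inverse)

lemma spd_invertible: "spd B \<Longrightarrow> invertible B"
  by (rule invertible_if_trivial_kernel) (force simp: spd_def)

lemma matrix_inv_cancel:
  fixes B :: "real^'n^'n"
  assumes "invertible B"
  shows "B *v (matrix_inv B *v x) = x" "matrix_inv B *v (B *v x) = x"
proof -
  have "B ** matrix_inv B = mat 1 \<and> matrix_inv B ** B = mat 1"
    using assms unfolding invertible_def matrix_inv_def by (rule someI_ex)
  then show "B *v (matrix_inv B *v x) = x" "matrix_inv B *v (B *v x) = x"
    by (simp_all add: matrix_vector_mul_assoc)
qed

lemma spd_inverse_swap: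
  assumes "spd B"
  shows "x \<bullet> (matrix_inv B *v y) = y \<bullet> (matrix_inv B *v x)"
  using spd_swap[OF assms, of "matrix_inv B *v x" "matrix_inv B *v y"]
    matrix_inv_cancel(1)[OF spd_invertible[OF assms]]
  by (simp add: inner_commute)

lemma transpose_eqI:
  fixes A :: "real^'n^'n"
  assumes "\<And>x y. x \<bullet> (A *v y) = y \<bullet> (A *v x)"
  shows "transpose A = A"
proof -
  have "(A *v y - transpose A *v y) \<bullet> x = 0" for x y
  proof -
    have "(transpose A *v y) \<bullet> x = y \<bullet> (A *v x)" by (simp add: dot_lmul_matrix)
    then show ?thesis
      using assms[of x y] inner_commute[of "A *v y" x] by (simp only: inner_diff_left)
  qed
  then have "A *v y = transpose A *v y" for y
    by (metis inner_eq_zero_iff right_minus_eq)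
  then show ?thesis by (metis matrix_eq)
qed

section \<open>Eigenvalues of symmetric definite pencils\<close>

lemma map_matrix_of_real_mult_vec:
  "(map_matrix complex_of_real Z *v v) $ i
     = Complex ((Z *v (\<chi> j. Re (v $ j))) $ i) ((Z *v (\<chi> j. Im (v $ j))) $ i)"
  by (simp add: matrix_vector_mult_def complex_eq_iff)

lemma of_real_eigenvalueI:
  assumes "w \<noteq> 0" "Z *v w = l *\<^sub>R w"
  shows "complex_of_real l \<in> eigenvalues Z"
proof -
  let ?v = "\<chi> i. complex_of_real (w $ i)"
  have "?v \<noteq> 0" using \<open>w \<noteq> 0\<close> by (auto simp: vec_eq_iff)
  moreover have "map_matrix complex_of_real Z *v ?v = complex_of_real l *s ?v"
  proof -
    have "Z *v (\<chi> j. 0) = 0" by (simp add: matrix_vector_mult_def vec_eq_iff)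
    then show ?thesis
      using assms(2) by (simp add: vec_eq_iff map_matrix_of_real_mult_vec complex_eq_iff)
  qed
  ultimately show ?thesis unfolding eigenvalues_def by blast
qed

text \<open>Split an eigenvector as \<open>p + i q\<close>. Symmetry of \<open>A\<close> makes the two mixed products of \<open>p\<close> and \<open>q\<close>
  agree, and their difference is the imaginary part of the eigenvalue times the positive number
  \<open>p \<bullet> (B *v p) + q \<bullet> (B *v q)\<close>. Once the eigenvalue is real, the nonzero one of \<open>p\<close>, \<open>q\<close> is a real
  eigenvector.\<close>

lemma pencil_eigenvalue_real:
  fixes A B :: "real^'n^'n"
  assumes A: "transpose A = A" and B: "spd B"
    and mu: "\<mu> \<in> eigenvalues (matrix_inv B ** A)"
  obtains l w where "\<mu> = complex_of_real l" "w \<noteq> 0" "A *v w = l *\<^sub>R (B *v w)"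
proof -
  let ?Z = "matrix_inv B ** A"
  obtain v where v: "v \<noteq> 0" "map_matrix complex_of_real ?Z *v v = \<mu> *s v"
    using mu unfolding eigenvalues_def by blast
  define p q where "p = (\<chi> i. Re (v $ i))" and "q = (\<chi> i. Im (v $ i))"
  have BZ: "B *v (?Z *v x) = A *v x" for x
    by (simp add: matrix_inv_cancel spd_invertible[OF B] flip: matrix_vector_mul_assoc)
  have "?Z *v p = Re \<mu> *\<^sub>R p - Im \<mu> *\<^sub>R q" "?Z *v q = Re \<mu> *\<^sub>R q + Im \<mu> *\<^sub>R p"
    using v(2) unfolding p_def q_def
    by (simp_all add: vec_eq_iff map_matrix_of_real_mult_vec complex_eq_iff)
  then have Ap: "A *v p = Re \<mu> *\<^sub>R (B *v p) - Im \<mu> *\<^sub>R (B *v q)"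
    and Aq: "A *v q = Re \<mu> *\<^sub>R (B *v q) + Im \<mu> *\<^sub>R (B *v p)"
    using BZ[of p] BZ[of q]
    by (simp_all add: matrix_vector_mult_diff_distrib matrix_vector_right_distrib
        matrix_vector_mult_scaleR)
  have pq: "p \<noteq> 0 \<or> q \<noteq> 0"
    using v(1) by (auto simp: vec_eq_iff complex_eq_iff p_def q_def)
  then have pos: "p \<bullet> (B *v p) + q \<bullet> (B *v q) > 0"
    using B spd_nonneg[OF B, of p] spd_nonneg[OF B, of q] unfolding spd_def
    by (metis add_pos_nonneg add_nonneg_pos)
  have "p \<bullet> (A *v q) = q \<bullet> (A *v p)"
    using symmetric_matrix_swap[OF A] .
  then have "Im \<mu> * (p \<bullet> (B *v p) + q \<bullet> (B *v q)) = 0"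
    using spd_swap[OF B, of p q]
    by (simp add: Ap Aq inner_diff_right inner_add_right algebra_simps)
  then have "Im \<mu> = 0" using pos by simp
  then have "\<mu> = complex_of_real (Re \<mu>)" "A *v p = Re \<mu> *\<^sub>R (B *v p)" "A *v q = Re \<mu> *\<^sub>R (B *v q)"
    using Ap Aq by (simp_all add: complex_eq_iff)
  then show ?thesis using pq that by blast
qed

text \<open>Eigenvectors for different eigenvalues are orthogonal in the inner product given by \<open>B\<close>, hence
  linearly independent.\<close>

lemma pencil_eigenvalues_finite:
  fixes A B :: "real^'n^'n"
  assumes A: "transpose A = A" and B: "spd B"
  shows "finite (eigenvalues (matrix_inv B ** A))"
proof -
  define L where "L = {l. \<exists>w. w \<noteq> 0 \<and> A *v w = l *\<^sub>R (B *v w)}"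
  have "\<forall>l\<in>L. \<exists>w. w \<noteq> 0 \<and> A *v w = l *\<^sub>R (B *v w)" by (simp add: L_def)
  then obtain f where f: "\<And>l. l \<in> L \<Longrightarrow> f l \<noteq> 0 \<and> A *v f l = l *\<^sub>R (B *v f l)"
    by (auto dest!: bchoice)
  have orth: "f l \<bullet> (B *v f k) = 0" if "l \<in> L" "k \<in> L" "l \<noteq> k" for l k
  proof -
    have "l * (f k \<bullet> (B *v f l)) = f k \<bullet> (A *v f l)" using f[OF \<open>l \<in> L\<close>] by simp
    also have "\<dots> = f l \<bullet> (A *v f k)" by (rule symmetric_matrix_swap[OF A])
    also have "\<dots> = k * (f l \<bullet> (B *v f k))" using f[OF \<open>k \<in> L\<close>] by simp
    finally show ?thesis using \<open>l \<noteq> k\<close> spd_swap[OF B, of "f k" "f l"] by simp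
  qed
  have self: "f l \<bullet> (B *v f l) > 0" if "l \<in> L" for l
    using f[OF that] B by (simp add: spd_def)
  have inj: "inj_on f L"
    using orth self by (intro inj_onI) (metis less_irrefl)
  have "independent (f ` L)"
    unfolding independent_explicit_finite_subsets
  proof (intro allI impI ballI)
    fix S u v assume S: "S \<subseteq> f ` L" "finite S" "(\<Sum>v\<in>S. u v *\<^sub>R v) = 0" and v: "v \<in> S"
    obtain l where l: "l \<in> L" "v = f l" using S v by blast
    have "0 = (\<Sum>w\<in>S. u w *\<^sub>R w) \<bullet> (B *v v)" using S by simp
    also have "\<dots> = (\<Sum>w\<in>S. u w * (w \<bullet> (B *v v)))" by (simp add: inner_sum_left)
    also have "\<dots> = (\<Sum>w\<in>S. if w = v then u v * (v \<bullet> (B *v v)) else 0)"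
    proof (rule sum.cong)
      fix w assume "w \<in> S"
      then obtain k where "k \<in> L" "w = f k" using S by blast
      then show "u w * (w \<bullet> (B *v v)) = (if w = v then u v * (v \<bullet> (B *v v)) else 0)"
        using orth[of k l] l by auto
    qed simp
    also have "\<dots> = u v * (v \<bullet> (B *v v))" using S v by simp
    finally show "u v = 0" using self[OF l(1)] l by simp
  qed
  then have "finite (f ` L)" using independent_bound by blast
  then have "finite L" using inj by (simp add: finite_image_iff)
  moreover have "eigenvalues (matrix_inv B ** A) \<subseteq> complex_of_real ` L"
    using pencil_eigenvalue_real[OF A B] unfolding L_def by blast
  ultimately show ?thesis by (meson finite_imageI finite_subset)
qed

text \<open>A nonzero \<open>C *v x\<close> would be a direction of descent: moving from \<open>x\<close> a little against it makes
  the quadratic form negative.\<close>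

lemma psd_isotropic_in_kernel:
  fixes C :: "real^'n^'n"
  assumes C: "transpose C = C" and nonneg: "\<And>x. 0 \<le> x \<bullet> (C *v x)" and x: "x \<bullet> (C *v x) = 0"
  shows "C *v x = 0"
proof -
  define y where "y = C *v x"
  let ?b = "y \<bullet> (C *v y)"
  have *: "0 \<le> t\<^sup>2 * ?b - 2 * t * (y \<bullet> y)" for t
  proof -
    have "0 \<le> (x - t *\<^sub>R y) \<bullet> (C *v (x - t *\<^sub>R y))" by (rule nonneg)
    also have "\<dots> = t\<^sup>2 * ?b - 2 * t * (y \<bullet> y)"
      using x symmetric_matrix_swap[OF C, of x y]
      by (simp add: matrix_vector_mult_diff_distrib matrix_vector_mult_scaleR inner_diff_left
          inner_diff_right power2_eq_square algebra_simps y_def)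
    finally show ?thesis .
  qed
  have "y \<bullet> y \<le> 0"
  proof (rule ccontr)
    assume "\<not> y \<bullet> y \<le> 0"
    then have yy: "y \<bullet> y > 0" by (simp only: not_le)
    have b: "?b \<ge> 0" by (rule nonneg)
    \<comment> \<open>The minimiser of the quadratic in \<open>t\<close> would be \<open>(y \<bullet> y) / ?b\<close>; adding \<open>1\<close> avoids the division
      by zero and keeps the value negative.\<close>
    define t where "t = (y \<bullet> y) / (?b + 1)"
    have t: "t > 0" "y \<bullet> y = t * (?b + 1)" using yy b by (simp_all add: t_def)
    have "0 \<le> t\<^sup>2 * ?b - 2 * t * (t * (?b + 1))" using *[of t] by (simp only: t(2))
    also have "\<dots> = t\<^sup>2 * (?b - 2 * (?b + 1))" by (simp add: power2_eq_square algebra_simps)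
    also have "\<dots> < 0" using t(1) b by (intro mult_pos_neg) auto
    finally show False by simp
  qed
  then show ?thesis unfolding y_def by (metis inner_eq_zero_iff inner_ge_zero order_antisym)
qed

text \<open>The maximum \<open>l\<close> of the Rayleigh quotient is an eigenvalue: \<open>l *\<^sub>R B - A\<close> is positive semidefinite
  and its quadratic form vanishes at the maximiser, which therefore lies in its kernel.\<close>

lemma pencil_eigenvalue_exists:
  fixes A B :: "real^'n^'n"
  assumes A: "transpose A = A" and B: "spd B"
  shows "eigenvalues (matrix_inv B ** A) \<noteq> {}"
proof -
  let ?R = "\<lambda>x. (x \<bullet> (A *v x)) / (x \<bullet> (B *v x))"
  have Bpos: "x \<bullet> (B *v x) > 0" if "x \<noteq> 0" for x using B that by (simp add: spd_def)
  have "\<exists>x\<in>sphere 0 1. \<forall>y\<in>sphere 0 1. ?R y \<le> ?R x"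
  proof (rule continuous_attains_sup)
    show "sphere 0 1 \<noteq> ({} :: (real^'n) set)" by simp
    show "continuous_on (sphere 0 1) ?R"
    proof (intro continuous_on_divide continuous_on_inner continuous_on_id
          linear_continuous_on matrix_vector_mul_bounded_linear ballI)
      fix y :: "real^'n" assume "y \<in> sphere 0 1"
      then have "y \<noteq> 0" by auto
      then show "y \<bullet> (B *v y) \<noteq> 0" using Bpos[of y] by (metis less_irrefl)
    qed
  qed simp
  then obtain x where x: "norm x = 1" and max: "\<And>y. norm y = 1 \<Longrightarrow> ?R y \<le> ?R x" by auto
  define l where "l = ?R x"
  define C where "C = l *\<^sub>R B - A"
  have Cq: "y \<bullet> (C *v y) = l * (y \<bullet> (B *v y)) - y \<bullet> (A *v y)" for y
    by (simp add: C_def matrix_vector_mult_diff_rdistrib scaleR_matrix_vector_assoc[symmetric]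
        inner_diff_right)
  have "x \<noteq> 0" using x by auto
  have "C *v x = 0"
  proof (rule psd_isotropic_in_kernel)
    show "transpose C = C"
      using A B by (simp add: C_def spd_def transpose_def vec_eq_iff)
    show "x \<bullet> (C *v x) = 0"
      using Bpos[OF \<open>x \<noteq> 0\<close>] by (simp add: Cq l_def)
    show "0 \<le> y \<bullet> (C *v y)" for y
    proof (cases "y = 0")
      case False
      have "?R y = ?R (y /\<^sub>R norm y)"
        using False by (simp add: matrix_vector_mult_scaleR)
      also have "\<dots> \<le> l" unfolding l_def by (rule max) (simp add: False)
      finally show ?thesis using Bpos[OF False] by (simp add: Cq field_simps)
    qed simp
  qed
  then have "A *v x = l *\<^sub>R (B *v x)"
    by (simp add: C_def matrix_vector_mult_diff_rdistrib scaleR_matrix_vector_assoc[symmetric])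
  then have "(matrix_inv B ** A) *v x = l *\<^sub>R x"
    by (simp add: matrix_vector_mult_scaleR matrix_inv_cancel spd_invertible[OF B]
        flip: matrix_vector_mul_assoc)
  then show ?thesis using of_real_eigenvalueI[OF \<open>x \<noteq> 0\<close>] by blast
qed

section \<open>Block matrices\<close>

definition upper :: "'a^('n::finite + 'm::finite) \<Rightarrow> 'a^'n" where "upper z = (\<chi> p. z $ Inl p)"
definition lower :: "'a^('n::finite + 'm::finite) \<Rightarrow> 'a^'m" where "lower z = (\<chi> p. z $ Inr p)"

lemma block_vector_eq_iff: "z = z' \<longleftrightarrow> upper z = upper z' \<and> lower z = lower z'"
  by (auto simp: vec_eq_iff upper_def lower_def) (metis sumE)

lemma upper_lower_simps [simp]:
  "upper 0 = 0" "lower 0 = 0"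
  "upper (c *\<^sub>R z) = c *\<^sub>R upper z" "lower (c *\<^sub>R z) = c *\<^sub>R lower z"
  by (simp_all add: vec_eq_iff upper_def lower_def)

lemma sum_UNIV_Plus:
  "(\<Sum>i\<in>UNIV. f i) = (\<Sum>p\<in>UNIV. f (Inl p)) + (\<Sum>p\<in>UNIV. f (Inr p :: 'n::finite + 'm::finite))"
  by (subst UNIV_Plus_UNIV[symmetric], subst sum.Plus) auto

lemma inner_block:
  fixes z z' :: "real^('n::finite + 'm::finite)"
  shows "z \<bullet> z' = upper z \<bullet> upper z' + lower z \<bullet> lower z'"
  by (simp add: inner_vec_def sum_UNIV_Plus upper_def lower_def)

lemma block_matrix_mult_vec:
  fixes A :: "real^'n^'n" and B :: "real^'m^'n" and C :: "real^'n^'m" and D :: "real^'m^'m"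
  shows "upper (block_matrix A B C D *v z) = A *v upper z + B *v lower z"
    and "lower (block_matrix A B C D *v z) = C *v upper z + D *v lower z"
  by (simp_all add: block_matrix_def matrix_vector_mult_def vec_eq_iff sum_UNIV_Plus
      upper_def lower_def)

lemma spd_block_diagonal:
  assumes "spd P" "spd Q"
  shows "spd (block_matrix P 0 0 Q)"
  unfolding spd_def
proof (intro conjI allI impI)
  have q: "z \<bullet> (block_matrix P 0 0 Q *v z')
      = upper z \<bullet> (P *v upper z') + lower z \<bullet> (Q *v lower z')" for z z'
    by (simp add: inner_block block_matrix_mult_vec)
  show "transpose (block_matrix P 0 0 Q) = block_matrix P 0 0 Q"
    by (rule transpose_eqI) (metis q assms spd_swap)
  show "0 < z \<bullet> (block_matrix P 0 0 Q *v z)" if "z \<noteq> 0" for z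
  proof (cases "upper z = 0")
    case True
    then have "lower z \<noteq> 0" using that block_vector_eq_iff[of z 0] by simp
    then show ?thesis
      using assms spd_nonneg[OF assms(1)] unfolding q by (metis spd_def add_nonneg_pos)
  next
    case False
    then show ?thesis
      using assms spd_nonneg[OF assms(2)] unfolding q by (metis spd_def add_pos_nonneg)
  qed
qed

section \<open>The preconditioned saddle point system\<close>

text \<open>Multiplied out, the preconditioner exceeds the Schur complement \<open>\<eta> K + M K\<^sup>-\<^sup>1 M\<close> by the term
  \<open>2 \<surd>\<eta> M\<close>. All later arguments use it in this form.\<close>

lemma schur_preconditioner_apply:
  fixes K M :: "real^'n^'n"
  assumes K: "spd K" and \<eta>: "\<eta> > 0"
  shows "(\<eta> *\<^sub>R ((K + (\<eta> powr (-1/2)) *\<^sub>R M) ** matrix_inv K ** (K + (\<eta> powr (-1/2)) *\<^sub>R M))) *v w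
     = \<eta> *\<^sub>R (K *v w) + (2 * sqrt \<eta>) *\<^sub>R (M *v w) + M *v (matrix_inv K *v (M *v w))"
proof -
  define c where "c = \<eta> powr (-1/2)"
  have c: "\<eta> * c = sqrt \<eta>" "\<eta> * (c * c) = 1"
  proof -
    have "c = inverse (sqrt \<eta>)"
      using \<eta> by (simp add: c_def powr_minus powr_half_sqrt)
    moreover have "\<eta> = sqrt \<eta> * sqrt \<eta>" using \<eta> by simp
    ultimately show "\<eta> * c = sqrt \<eta>" "\<eta> * (c * c) = 1"
      using \<eta> by (metis mult.assoc mult.right_neutral real_sqrt_eq_zero_cancel_iff right_inverse less_irrefl,
        metis mult.assoc mult.commute mult.right_neutral real_sqrt_eq_zero_cancel_iff right_inverse less_irrefl)
  qed
  note inv = matrix_inv_cancel[OF spd_invertible[OF K]]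
  define y where "y = matrix_inv K *v (M *v w)"
  have Ky: "K *v y = M *v w" by (simp only: y_def inv)
  have Q: "(K + c *\<^sub>R M) *v v = K *v v + c *\<^sub>R (M *v v)" for v
    by (simp only: matrix_vector_mult_add_rdistrib scaleR_matrix_vector_assoc)
  have "matrix_inv K *v ((K + c *\<^sub>R M) *v w) = w + c *\<^sub>R y"
    by (simp only: Q matrix_vector_right_distrib matrix_vector_mult_scaleR inv y_def)
  then have "(\<eta> *\<^sub>R ((K + c *\<^sub>R M) ** matrix_inv K ** (K + c *\<^sub>R M))) *v w
    = \<eta> *\<^sub>R ((K + c *\<^sub>R M) *v (w + c *\<^sub>R y))"
    by (simp only: scaleR_matrix_vector_assoc[symmetric] matrix_vector_mul_assoc[symmetric])
  also have "\<dots> = \<eta> *\<^sub>R (K *v w) + (2 * (\<eta> * c)) *\<^sub>R (M *v w) + (\<eta> * (c * c)) *\<^sub>R (M *v y)"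
    unfolding Q by (simp add: vec_eq_iff matrix_vector_right_distrib matrix_vector_mult_scaleR Ky
        algebra_simps)
  finally show ?thesis by (simp only: c y_def scaleR_one flip: c_def)
qed

lemma spd_schur_preconditioner:
  fixes K M S :: "real^'n^'n"
  assumes K: "spd K" and M: "spd M" and \<eta>: "\<eta> > 0"
    and S: "\<And>w. S *v w = \<eta> *\<^sub>R (K *v w) + (2 * sqrt \<eta>) *\<^sub>R (M *v w) + M *v (matrix_inv K *v (M *v w))"
  shows "spd S"
  unfolding spd_def
proof (intro conjI allI impI)
  note inv = matrix_inv_cancel[OF spd_invertible[OF K]]
  have MKM: "v \<bullet> (M *v (matrix_inv K *v (M *v w))) = (M *v v) \<bullet> (matrix_inv K *v (M *v w))" for v w
    by (metis spd_swap[OF M] inner_commute)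
  show "transpose S = S"
  proof (rule transpose_eqI)
    fix v w
    show "v \<bullet> (S *v w) = w \<bullet> (S *v v)"
      using spd_swap[OF K, of v w] spd_swap[OF M, of v w]
        spd_inverse_swap[OF K, of "M *v v" "M *v w"]
      by (simp add: S inner_add_right MKM)
  qed
  fix w :: "real^'n" assume "w \<noteq> 0"
  define y where "y = matrix_inv K *v (M *v w)"
  have "M *v w = K *v y" by (simp add: y_def inv)
  then have "w \<bullet> (M *v y) = y \<bullet> (K *v y)"
    using spd_swap[OF M, of w y] by simp
  moreover have "w \<bullet> (K *v w) > 0" using K \<open>w \<noteq> 0\<close> by (simp add: spd_def)
  ultimately show "0 < w \<bullet> (S *v w)"
    using \<eta> spd_nonneg[OF M, of w] spd_nonneg[OF K, of y]
    by (simp add: S inner_add_right y_def[symmetric] add_pos_nonneg)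
qed

text \<open>Write \<open>f\<close> for the quadratic polynomial in \<open>\<mu>\<close>. At \<open>- (\<surd>2 - 1)\<close> its value is
  \<open>- (\<surd>2 - 1) (n + 2 k - 2 \<surd>2 m) \<le> 0\<close>, and since the coefficient of \<open>\<mu>\<close> is negative, \<open>f\<close> is negative
  at all smaller moduli. The golden ratio \<open>g\<close> satisfies \<open>g\<^sup>2 = g + 1\<close>, which gives
  \<open>f g = g k + 2 m > 0\<close>, and \<open>f\<close> stays positive at all larger moduli.\<close>

lemma quadratic_root_bounds:
  fixes k m n \<mu> :: real
  assumes k: "k > 0" and m: "m > 0" and n: "n \<ge> 0" and cs: "2 * sqrt 2 * m \<le> n + 2 * k"
    and root: "\<mu>\<^sup>2 * (k + 2 * m + n) - \<mu> * (2 * m + n) - (k + n) = 0"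
  shows "sqrt 2 - 1 \<le> \<bar>\<mu>\<bar>" and "\<bar>\<mu>\<bar> < (sqrt 5 + 1) / 2"
proof -
  define r where "r = sqrt 2"
  have r: "r\<^sup>2 = 2" "r > 1" by (simp_all add: r_def)
  define a where "a = r - 1"
  have a0: "a > 0" using r by (simp add: a_def)
  have a2: "a\<^sup>2 = 3 - 2 * r" using r(1) by (simp add: a_def power2_eq_square algebra_simps)
  have fa: "a\<^sup>2 * (k + 2 * m + n) + a * (2 * m + n) - (k + n) \<le> 0"
  proof -
    have "a\<^sup>2 * (k + 2 * m + n) + a * (2 * m + n) - (k + n) = - a * (n + 2 * k - 2 * r * m)"
      unfolding a2 a_def using r(1) by (simp add: power2_eq_square algebra_simps)
    then show ?thesis using cs a0 by (simp add: r_def)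
  qed
  show "sqrt 2 - 1 \<le> \<bar>\<mu>\<bar>"
  proof (rule ccontr)
    assume "\<not> sqrt 2 - 1 \<le> \<bar>\<mu>\<bar>"
    then have lt: "\<bar>\<mu>\<bar> < a" by (simp add: a_def r_def)
    have "\<mu>\<^sup>2 < a\<^sup>2" using lt a0 power_strict_mono[of "\<bar>\<mu>\<bar>" a 2] by simp
    then have "\<mu>\<^sup>2 * (k + 2 * m + n) < a\<^sup>2 * (k + 2 * m + n)"
      using k m n by (intro mult_strict_right_mono) auto
    moreover have "- \<mu> * (2 * m + n) \<le> a * (2 * m + n)"
      using lt m n by (intro mult_right_mono) auto
    ultimately show False using fa root by (simp add: algebra_simps)
  qed
  define g where "g = (sqrt 5 + 1) / (2::real)"
  have g2: "g\<^sup>2 = g + 1" by (simp add: g_def power2_eq_square field_simps)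
  have g0: "g > 1" using real_sqrt_gt_1_iff[of 5] by (simp add: g_def)
  show "\<bar>\<mu>\<bar> < (sqrt 5 + 1) / 2"
  proof (rule ccontr)
    assume "\<not> \<bar>\<mu>\<bar> < (sqrt 5 + 1) / 2"
    then have ge: "g \<le> \<bar>\<mu>\<bar>" by (simp add: g_def)
    define X Y where "X = k + 2 * m + n" and "Y = 2 * m + n"
    have XY: "0 \<le> X" "0 \<le> Y" "Y \<le> X" using k m n by (simp_all add: X_def Y_def)
    have expand: "t * (t * X - Y) = t\<^sup>2 * X - t * Y" for t
      by (simp add: power2_eq_square algebra_simps)
    \<comment> \<open>The product \<open>t (t X - Y)\<close> grows with \<open>t\<close> from \<open>t = g\<close> on, where it already exceeds \<open>k + n\<close>.\<close>
    have "0 < g * k + 2 * m" using g0 k m by (simp add: add_pos_pos)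
    also have "\<dots> = g\<^sup>2 * X - g * Y - (k + n)"
      unfolding g2 X_def Y_def by (simp add: algebra_simps)
    also have "\<dots> = g * (g * X - Y) - (k + n)" by (simp only: expand)
    also have "\<dots> \<le> \<bar>\<mu>\<bar> * (\<bar>\<mu>\<bar> * X - Y) - (k + n)"
    proof -
      have "1 * Y \<le> g * X" using g0 XY by (intro mult_mono) auto
      moreover have "g * X \<le> \<bar>\<mu>\<bar> * X" using ge XY by (intro mult_right_mono) auto
      ultimately show ?thesis using ge g0 XY by (intro diff_right_mono mult_mono) auto
    qed
    also have "\<dots> = \<mu>\<^sup>2 * X - \<bar>\<mu>\<bar> * Y - (k + n)" by (simp only: expand power2_abs)
    also have "\<dots> \<le> \<mu>\<^sup>2 * X - \<mu> * Y - (k + n)"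
      using XY by (simp add: mult_right_mono)
    also have "\<dots> = 0" using root by (simp only: X_def Y_def)
    finally show False by simp
  qed
qed

text \<open>Pairing the second block row with \<open>(\<mu> - 1) w\<close> rather than solving the first one for \<open>u\<close> avoids
  a division by \<open>\<mu> - 1\<close>, so \<open>\<mu> = 1\<close> needs no separate treatment.\<close>

lemma preconditioned_eigenvalue_bounds:
  fixes K M S :: "real^'n^'n"
  assumes K: "spd K" and M: "spd M" and \<eta>: "\<eta> > 0"
    and S: "\<And>w. S *v w = \<eta> *\<^sub>R (K *v w) + (2 * sqrt \<eta>) *\<^sub>R (M *v w) + M *v (matrix_inv K *v (M *v w))"
    and "z \<noteq> 0"
    and ev: "block_matrix K M M (- (\<eta> *\<^sub>R K)) *v z = \<mu> *\<^sub>R (block_matrix K 0 0 S *v z)"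
  shows "sqrt 2 - 1 \<le> \<bar>\<mu>\<bar>" and "\<bar>\<mu>\<bar> < (sqrt 5 + 1) / 2"
proof -
  define u w where "u = upper z" and "w = lower z"
  have e1: "K *v u + M *v w = \<mu> *\<^sub>R (K *v u)"
    using arg_cong[OF ev, of upper] by (simp add: block_matrix_mult_vec u_def w_def)
  have e2: "M *v u - \<eta> *\<^sub>R (K *v w) = \<mu> *\<^sub>R (S *v w)"
  proof -
    have "(- (\<eta> *\<^sub>R K)) *v x = - (\<eta> *\<^sub>R (K *v x))" for x
      using matrix_vector_mult_diff_rdistrib[of 0 "\<eta> *\<^sub>R K" x]
      by (simp add: scaleR_matrix_vector_assoc[symmetric])
    then show ?thesis
      using arg_cong[OF ev, of lower] by (simp add: block_matrix_mult_vec u_def w_def)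
  qed
  note inv = matrix_inv_cancel[OF spd_invertible[OF K]]
  define y where "y = matrix_inv K *v (M *v w)"
  have Ky: "K *v y = M *v w" by (simp add: y_def inv)
  have "K *v (y - (\<mu> - 1) *\<^sub>R u) = 0"
    using e1 Ky by (simp add: matrix_vector_mult_diff_distrib matrix_vector_mult_scaleR algebra_simps)
  then have yu: "y = (\<mu> - 1) *\<^sub>R u"
    by (metis inv(2) matrix_vector_mult_0_right right_minus_eq)
  have "w \<noteq> 0"
  proof
    assume "w = 0"
    then have "M *v u = 0" using e2 by simp
    then have "u = 0" using M by (force simp: spd_def)
    then show False using \<open>w = 0\<close> \<open>z \<noteq> 0\<close> block_vector_eq_iff[of z 0] by (simp add: u_def w_def)
  qed
  define k m n where "k = \<eta> * (w \<bullet> (K *v w))" and "m = sqrt \<eta> * (w \<bullet> (M *v w))"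
    and "n = y \<bullet> (K *v y)"
  have k: "k > 0" and m: "m > 0"
    using \<open>w \<noteq> 0\<close> K M \<eta> by (simp_all add: k_def m_def spd_def)
  have n: "n \<ge> 0" unfolding n_def by (rule spd_nonneg[OF K])
  have wMy: "w \<bullet> (M *v y) = n"
    using spd_swap[OF M, of w y] by (simp add: n_def Ky)
  have cs: "2 * sqrt 2 * m \<le> n + 2 * k"
  proof -
    \<comment> \<open>With this \<open>s\<close> the energy of \<open>y - s *\<^sub>R w\<close> is exactly the difference of the two sides.\<close>
    define s where "s = sqrt 2 * sqrt \<eta>"
    have s2: "s * s = 2 * \<eta>" using \<eta> by (simp add: s_def flip: real_sqrt_mult)
    have "0 \<le> (y - s *\<^sub>R w) \<bullet> (K *v (y - s *\<^sub>R w))" by (rule spd_nonneg[OF K])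
    also have "\<dots> = n - 2 * s * (w \<bullet> (K *v y)) + (s * s) * (w \<bullet> (K *v w))"
      using spd_swap[OF K, of y w]
      by (simp add: matrix_vector_mult_diff_distrib matrix_vector_mult_scaleR inner_diff_left
          inner_diff_right n_def algebra_simps)
    also have "\<dots> = n - 2 * sqrt 2 * m + 2 * k"
      unfolding s2 Ky by (simp add: s_def m_def k_def)
    finally show ?thesis by simp
  qed
  have "(\<mu> - 1) * (w \<bullet> (M *v u)) - (\<mu> - 1) * k = (\<mu> - 1) * \<mu> * (w \<bullet> (S *v w))"
    using arg_cong[OF e2, of "\<lambda>t. (\<mu> - 1) * (w \<bullet> t)"]
    by (simp add: inner_diff_right k_def algebra_simps)
  moreover have "(\<mu> - 1) * (w \<bullet> (M *v u)) = n"
    using wMy by (simp add: yu matrix_vector_mult_scaleR)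
  moreover have "w \<bullet> (S *v w) = k + 2 * m + n"
    by (simp add: S inner_add_right y_def[symmetric] wMy k_def m_def)
  ultimately have "\<mu>\<^sup>2 * (k + 2 * m + n) - \<mu> * (2 * m + n) - (k + n) = 0"
    by (simp add: power2_eq_square algebra_simps)
  from quadratic_root_bounds[OF k m n cs this]
  show "sqrt 2 - 1 \<le> \<bar>\<mu>\<bar>" and "\<bar>\<mu>\<bar> < (sqrt 5 + 1) / 2" .
qed

text \<open>Invertibility of the preconditioned matrix is the bound on the eigenvalues at \<open>\<mu> = 0\<close>: a kernel
  vector would be an eigenvector whose eigenvalue has modulus less than \<open>\<surd>2 - 1\<close>.\<close>

lemma block_preconditioned_condition_number:
  fixes K M S :: "real^'n^'n" and \<eta> :: real
  defines "A \<equiv> block_matrix K M M (- (\<eta> *\<^sub>R K))" and "B \<equiv> block_matrix K 0 0 S"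
  assumes K: "spd K" and M: "spd M" and \<eta>: "\<eta> > 0"
    and S: "S = \<eta> *\<^sub>R ((K + (\<eta> powr (-1/2)) *\<^sub>R M) ** matrix_inv K
                          ** (K + (\<eta> powr (-1/2)) *\<^sub>R M))"
  shows "invertible B" "invertible (matrix_inv B ** A)" "eigenvalues (matrix_inv B ** A) \<subseteq> \<real>"
    "cond_number (matrix_inv B ** A) < (sqrt 5 + 1) / (2 * (sqrt 2 - 1))"
proof -
  let ?Z = "matrix_inv B ** A"
  have Sw: "S *v w = \<eta> *\<^sub>R (K *v w) + (2 * sqrt \<eta>) *\<^sub>R (M *v w) + M *v (matrix_inv K *v (M *v w))" for w
    unfolding S by (rule schur_preconditioner_apply[OF K \<eta>])
  have B: "spd B"
    unfolding B_def by (intro spd_block_diagonal K spd_schur_preconditioner[OF K M \<eta> Sw])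
  have A: "transpose A = A"
    using K M by (auto simp: A_def spd_def transpose_def block_matrix_def vec_eq_iff split: sum.split)
  note bounds = preconditioned_eigenvalue_bounds[OF K M \<eta> Sw, folded A_def B_def]
  have a0: "sqrt 2 - 1 > (0::real)" by simp
  show "invertible B" using B by (rule spd_invertible)
  show "invertible ?Z"
  proof (rule invertible_if_trivial_kernel)
    fix z assume "?Z *v z = 0"
    then have "A *v z = 0 *\<^sub>R (B *v z)"
      by (metis matrix_inv_cancel(1) matrix_vector_mul_assoc matrix_vector_mult_0_right
          scaleR_zero_left spd_invertible[OF B])
    then show "z = 0" using bounds(1)[of z 0] a0 by fastforce
  qed
  show "eigenvalues ?Z \<subseteq> \<real>"
    using pencil_eigenvalue_real[OF A B] by (metis Reals_of_real subsetI)
  have cmod: "sqrt 2 - 1 \<le> cmod \<mu> \<and> cmod \<mu> < (sqrt 5 + 1) / 2" if "\<mu> \<in> eigenvalues ?Z" for \<mu>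
    using pencil_eigenvalue_real[OF A B that] bounds by (metis norm_of_real)
  let ?E = "cmod ` eigenvalues ?Z"
  have E: "finite ?E" "?E \<noteq> {}"
    using pencil_eigenvalues_finite[OF A B] pencil_eigenvalue_exists[OF A B] by auto
  have "Min ?E \<in> ?E" "Max ?E \<in> ?E" by (rule Min_in[OF E], rule Max_in[OF E])
  then have "sqrt 2 - 1 \<le> Min ?E" "0 \<le> Max ?E" "Max ?E < (sqrt 5 + 1) / 2" using cmod by auto
  then have "Max ?E / Min ?E < ((sqrt 5 + 1) / 2) / (sqrt 2 - 1)"
    using a0 by (intro frac_less) auto
  then show "cond_number ?Z < (sqrt 5 + 1) / (2 * (sqrt 2 - 1))"
    by (simp add: cond_number_def)
qed

section \<open>Gram matrices\<close>

text \<open>The mass and the stiffness matrix are both of this form, with \<open>g p\<close> the basis functions or their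
  gradients. The quadratic form at \<open>x\<close> is the integral of the squared norm of the combination with
  coefficients \<open>x\<close>.\<close>

lemma gram_matrix:
  fixes g :: "'n::finite \<Rightarrow> 'z \<Rightarrow> 'b::real_inner" and x :: "real^'n"
  assumes int: "\<And>p q. set_integrable N S (\<lambda>z. g p z \<bullet> g q z)"
  defines "G \<equiv> \<chi> p q. LINT z:S|N. g p z \<bullet> g q z"
  shows "transpose G = G" and "0 \<le> x \<bullet> (G *v x)"
    and "x \<bullet> (G *v x) = 0 \<Longrightarrow> AE z in N. z \<in> S \<longrightarrow> (\<Sum>p\<in>UNIV. x $ p *\<^sub>R g p z) = 0"
proof -
  show "transpose G = G"
    by (simp add: G_def transpose_def inner_commute)
  let ?s = "\<lambda>z. \<Sum>p\<in>UNIV. x $ p *\<^sub>R g p z"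
  let ?f = "\<lambda>z. indicator S z *\<^sub>R (?s z \<bullet> ?s z)"
  have expand: "?f z = (\<Sum>p\<in>UNIV. \<Sum>q\<in>UNIV. x $ p * x $ q * (indicator S z *\<^sub>R (g p z \<bullet> g q z)))" for z
  proof -
    have "?s z \<bullet> ?s z = (\<Sum>p\<in>UNIV. \<Sum>q\<in>UNIV. x $ p * x $ q * (g p z \<bullet> g q z))"
      by (subst inner_sum_left) (simp add: inner_sum_right mult_ac)
    then show ?thesis by (simp add: sum_distrib_left mult_ac)
  qed
  have int': "integrable N (\<lambda>z. indicator S z *\<^sub>R (g p z \<bullet> g q z))" for p q
    using int unfolding set_integrable_def .
  have intf: "integrable N ?f"
    unfolding expand by (intro Bochner_Integration.integrable_sum integrable_mult_right int')
  have "(LINT z|N. ?f z) = (\<Sum>p\<in>UNIV. LINT z|N. (\<Sum>q\<in>UNIV.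
      x $ p * x $ q * (indicator S z *\<^sub>R (g p z \<bullet> g q z))))"
    unfolding expand
    by (intro Bochner_Integration.integral_sum Bochner_Integration.integrable_sum
        integrable_mult_right int')
  also have "\<dots> = (\<Sum>p\<in>UNIV. \<Sum>q\<in>UNIV. LINT z|N.
      x $ p * x $ q * (indicator S z *\<^sub>R (g p z \<bullet> g q z)))"
    by (intro sum.cong refl Bochner_Integration.integral_sum integrable_mult_right int')
  also have "\<dots> = (\<Sum>p\<in>UNIV. \<Sum>q\<in>UNIV. x $ p * x $ q * G $ p $ q)"
    by (simp only: integral_mult_right_zero G_def vec_lambda_beta set_lebesgue_integral_def)
  also have "\<dots> = x \<bullet> (G *v x)"
    by (simp add: inner_vec_def matrix_vector_mult_def sum_distrib_left algebra_simps)
  finally have eq: "x \<bullet> (G *v x) = (LINT z|N. ?f z)" by simp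
  have nonneg: "0 \<le> ?f z" for z by (simp add: indicator_def)
  show "0 \<le> x \<bullet> (G *v x)"
    unfolding eq by (rule Bochner_Integration.integral_nonneg) (rule nonneg)
  show "AE z in N. z \<in> S \<longrightarrow> ?s z = 0" if "x \<bullet> (G *v x) = 0"
  proof -
    have "AE z in N. ?f z = 0"
      using that integral_nonneg_eq_0_iff_AE[OF intf] nonneg unfolding eq by simp
    then show ?thesis by eventually_elim (auto simp: indicator_def)
  qed
qed

section \<open>Meshes and piecewise linear functions\<close>

lemma unit_square_facts:
  shows "open unit_square" and "unit_square \<noteq> {}" and "compact (closure unit_square)"
    and "connected (closure unit_square)" and "interior (closure unit_square) = unit_square"
proof -
  have cl: "closure unit_square = {0..1} \<times> {0..1}"
    by (simp add: unit_square_def closure_Times)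
  show "open unit_square" by (simp add: unit_square_def open_Times)
  show "unit_square \<noteq> {}"
    using dense[of 0 "1::real"] by (auto simp: unit_square_def)
  show "compact (closure unit_square)" by (simp add: cl compact_Times)
  show "connected (closure unit_square)"
    unfolding cl by (intro convex_connected convex_Times) auto
  show "interior (closure unit_square) = unit_square"
    unfolding cl by (simp add: unit_square_def interior_Times)
qed

lemma AE_open_witness:
  fixes U :: "'a::euclidean_space set"
  assumes "open U" "U \<noteq> {}" "AE z in lebesgue. z \<in> U \<longrightarrow> P z"
  shows "\<exists>z\<in>U. P z"
proof (rule ccontr)
  assume no: "\<not> (\<exists>z\<in>U. P z)"
  obtain N where "N \<in> null_sets lebesgue" "{z \<in> space lebesgue. \<not> (z \<in> U \<longrightarrow> P z)} \<subseteq> N"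
    using assms(3) unfolding eventually_ae_filter by blast
  then have "negligible U"
    using no by (intro negligible_subset[of N U]) (auto simp: negligible_iff_null_sets)
  then show False using open_not_negligible assms by blast
qed

lemma set_integrable_continuous_on_square:
  fixes f :: "real \<times> real \<Rightarrow> real"
  assumes "continuous_on (closure unit_square) f"
  shows "set_integrable lebesgue unit_square f"
proof -
  have "integrable lborel (\<lambda>z. indicator (closure unit_square) z *\<^sub>R f z)"
    by (rule borel_integrable_compact[OF unit_square_facts(3) assms])
  then have "set_integrable lebesgue (closure unit_square) f"
    unfolding set_integrable_def by (simp add: integrable_completion)
  then show ?thesis
    by (rule set_integrable_subset) (use unit_square_facts(1) closure_subset in auto)
qed

text \<open>The set where \<open>u\<close> is nonzero is open in the square, and a nonempty open set is not negligible. The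
  boundary follows by continuity, which is needed because mesh nodes lie there too.\<close>

lemma continuous_on_square_AE_0:
  fixes u :: "real \<times> real \<Rightarrow> real"
  assumes cont: "continuous_on (closure unit_square) u"
    and ae: "AE z in lebesgue. z \<in> unit_square \<longrightarrow> u z = 0"
    and z: "z \<in> closure unit_square"
  shows "u z = 0"
proof -
  have "continuous_on unit_square u"
    using cont closure_subset by (rule continuous_on_subset)
  then have "open (unit_square \<inter> u -` (- {0}))"
    by (intro continuous_open_preimage unit_square_facts) auto
  then have "unit_square \<inter> u -` (- {0}) = {}"
    using AE_open_witness[of "unit_square \<inter> u -` (- {0})" "\<lambda>z. u z = 0"] ae by auto
  then show ?thesis
    using continuous_constant_on_closure[OF cont _ z, of 0] by auto
qed

lemma grad_affine_on_open:
  assumes "open U" "z \<in> U" "\<And>y. y \<in> U \<Longrightarrow> f y = a \<bullet> y + b"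
  shows "grad f z = a"
proof -
  have "((\<lambda>y. a \<bullet> y + b) has_derivative (\<lambda>h. h \<bullet> a)) (at z)"
    by (auto intro!: derivative_eq_intros simp: inner_commute)
  then have "(f has_derivative (\<lambda>h. h \<bullet> a)) (at z)"
    using assms by (elim has_derivative_transform_within_open) auto
  then have "GDERIV f z :> a" unfolding gderiv_def .
  moreover have "D = a" if "GDERIV f z :> D" for D
  proof -
    have "(\<lambda>h. h \<bullet> D) = (\<lambda>h. h \<bullet> a)"
      using that \<open>GDERIV f z :> a\<close> unfolding gderiv_def by (rule has_derivative_unique)
    then show ?thesis by (metis vector_eq_ldot)
  qed
  ultimately show ?thesis unfolding grad_def by (rule the_equality)
qed

context
  fixes \<T> :: "(real \<times> real) set set"
  assumes mesh: "is_mesh \<T>"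
begin

lemma mesh_finite: "finite \<T>"
  using mesh by (simp add: is_mesh_def triangulation_def)

lemma mesh_Union: "\<Union>\<T> = closure unit_square"
  using mesh by (simp add: is_mesh_def)

lemma mesh_triangle:
  assumes "T \<in> \<T>"
  shows "convex T" and "closed T" and "interior T \<noteq> {}" and "interior T \<subseteq> unit_square"
proof -
  have s: "2 simplex T" using assms mesh by (simp add: is_mesh_def)
  show "convex T" "closed T" using convex_simplex[OF s] closed_simplex[OF s] .
  have "aff_dim T = int (DIM(real \<times> real))" using aff_dim_simplex[OF s] by simp
  then have "affine hull T = UNIV" using aff_dim_eq_full by blast
  then have "interior T = rel_interior T" by (rule rel_interior_interior[symmetric])
  moreover have "T \<noteq> {}" using s by auto
  ultimately show "interior T \<noteq> {}" using rel_interior_eq_empty \<open>convex T\<close> by auto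
  show "interior T \<subseteq> unit_square"
    using interior_mono[of T "closure unit_square"] assms mesh_Union unit_square_facts(5) by auto
qed

lemma mesh_nodes_subset: "mesh_nodes \<T> \<subseteq> closure unit_square"
  using mesh_Union by (auto simp: mesh_nodes_def extreme_point_of_def)

text \<open>The boundary of a convex set is negligible, so gradients, which are controlled in the interiors of
  the triangles only, are known almost everywhere.\<close>

lemma mesh_interiors_cover:
  obtains N where "negligible N" "unit_square \<subseteq> (\<Union>T\<in>\<T>. interior T) \<union> N"
proof
  show "negligible (\<Union>T\<in>\<T>. frontier T)"
    using mesh_finite mesh_triangle(1) by (intro negligible_Union) (auto intro: negligible_convex_frontier)
  show "unit_square \<subseteq> (\<Union>T\<in>\<T>. interior T) \<union> (\<Union>T\<in>\<T>. frontier T)"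
  proof
    fix z assume "z \<in> unit_square"
    then obtain T where "T \<in> \<T>" "z \<in> T" using mesh_Union closure_subset by blast
    then show "z \<in> (\<Union>T\<in>\<T>. interior T) \<union> (\<Union>T\<in>\<T>. frontier T)"
      using mesh_triangle(2) by (auto simp: frontier_def)
  qed
qed

lemma P1_grad:
  assumes "v \<in> P1_space \<T>" "T \<in> \<T>"
  obtains a b where "\<And>z. z \<in> T \<Longrightarrow> v z = a \<bullet> z + b" "\<And>z. z \<in> interior T \<Longrightarrow> grad v z = a"
proof -
  obtain a b where ab: "\<And>z. z \<in> T \<Longrightarrow> v z = a \<bullet> z + b"
    using assms unfolding P1_space_def by blast
  moreover have "grad v z = a" if "z \<in> interior T" for z
    using that ab interior_subset by (intro grad_affine_on_open[of "interior T" _ _ _ b]) auto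
  ultimately show ?thesis using that by blast
qed

text \<open>The integrand is constant in the interior of each triangle, and what remains of the square is
  negligible. Lebesgue measure being complete, arbitrary values there do not harm measurability.\<close>

lemma P1_grad_inner_integrable:
  assumes "v \<in> P1_space \<T>" "w \<in> P1_space \<T>"
  shows "set_integrable lebesgue unit_square (\<lambda>z. grad v z \<bullet> grad w z)"
proof -
  let ?f = "\<lambda>z. grad v z \<bullet> grad w z"
  have "set_integrable lebesgue (interior T) ?f" if T: "T \<in> \<T>" for T
  proof -
    obtain a b where "\<And>z. z \<in> interior T \<Longrightarrow> grad v z = a" "\<And>z. z \<in> interior T \<Longrightarrow> grad w z = b"
      using P1_grad assms T by metis
    then have eq: "\<And>z. z \<in> interior T \<Longrightarrow> ?f z = a \<bullet> b" by simp
    have "set_integrable lebesgue unit_square (\<lambda>z. a \<bullet> b)"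
      by (rule set_integrable_continuous_on_square) (rule continuous_on_const)
    then have "set_integrable lebesgue (interior T) (\<lambda>z. a \<bullet> b)"
      by (rule set_integrable_subset) (use mesh_triangle(4)[OF T] in auto)
    then show ?thesis using eq by (subst set_integrable_cong[OF refl refl]) auto
  qed
  then have *: "set_integrable lebesgue (\<Union>T\<in>\<T>. interior T) ?f"
    by (intro set_integrable_UN mesh_finite) auto
  obtain N where N: "negligible N" "unit_square \<subseteq> (\<Union>T\<in>\<T>. interior T) \<union> N"
    by (rule mesh_interiors_cover)
  have "set_integrable lebesgue N ?f"
    by (rule absolutely_integrable_negligible[OF N(1)])
  with * have "set_integrable lebesgue ((\<Union>T\<in>\<T>. interior T) \<union> N) ?f"
    using N(1) mesh_finite
    by (intro set_integrable_Un) (auto simp: negligible_iff_null_sets intro!: sets.finite_UN)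
  then show ?thesis
    by (rule set_integrable_subset) (use N(2) unit_square_facts(1) in auto)
qed

text \<open>A continuous function with finitely many values on a connected set is constant, and one
  value per triangle leaves finitely many.\<close>

lemma P1_locally_constant_imp_constant:
  assumes cont: "continuous_on (closure unit_square) u"
    and const: "\<And>T. T \<in> \<T> \<Longrightarrow> u constant_on T"
  obtains c where "\<And>z. z \<in> closure unit_square \<Longrightarrow> u z = (c::real)"
proof -
  have "finite (u ` T)" if T: "T \<in> \<T>" for T
  proof -
    obtain c where "\<And>z. z \<in> T \<Longrightarrow> u z = c" using const[OF T] by (auto simp: constant_on_def)
    then have "u ` T \<subseteq> {c}" by auto
    then show ?thesis by (rule finite_subset) simp
  qed
  then have "finite (u ` closure unit_square)"
    using mesh_finite by (simp flip: mesh_Union add: image_Union)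
  then have "u constant_on closure unit_square"
    by (rule continuous_finite_range_constant[OF unit_square_facts(4) cont])
  then show ?thesis using that by (auto simp: constant_on_def)
qed

context
  fixes x :: "'n::finite \<Rightarrow> real \<times> real" and \<phi> :: "'n \<Rightarrow> real \<times> real \<Rightarrow> real"
  assumes numbering: "node_numbering \<T> x" and basis: "nodal_basis \<T> x \<phi>"
begin

lemma basis_P1: "\<phi> p \<in> P1_space \<T>"
  using basis by (simp add: nodal_basis_def)

lemma basis_continuous: "continuous_on (closure unit_square) (\<phi> p)"
  using basis_P1 by (simp add: P1_space_def)

lemma combination_continuous:
  "continuous_on (closure unit_square) (\<lambda>z. \<Sum>p\<in>UNIV. v $ p *\<^sub>R \<phi> p z)"
  by (intro continuous_intros basis_continuous)

lemma combination_eq_0: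
  assumes "\<And>z. z \<in> closure unit_square \<Longrightarrow> (\<Sum>p\<in>UNIV. v $ p *\<^sub>R \<phi> p z) = 0"
  shows "v = 0"
proof -
  have "v $ q = 0" for q
  proof -
    have "x q \<in> closure unit_square"
      using numbering mesh_nodes_subset by (auto simp: node_numbering_def bij_betw_def)
    then have "0 = (\<Sum>p\<in>UNIV. v $ p *\<^sub>R \<phi> p (x q))" using assms by simp
    also have "\<dots> = (\<Sum>p\<in>UNIV. if p = q then v $ q else 0)"
      using basis by (intro sum.cong) (auto simp: nodal_basis_def)
    finally show ?thesis by simp
  qed
  then show ?thesis by (simp add: vec_eq_iff)
qed

text \<open>A function of vanishing \<open>L\<^sup>2\<close> norm is zero almost everywhere, hence everywhere by continuity, and
  its nodal values are the coefficients.\<close>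

lemma mass_matrix_spd: "spd (mass_matrix \<phi>)"
proof -
  have int: "set_integrable lebesgue unit_square (\<lambda>z. \<phi> p z \<bullet> \<phi> q z)" for p q
    by (intro set_integrable_continuous_on_square continuous_intros basis_continuous)
  have M: "mass_matrix \<phi> = (\<chi> p q. LINT z:unit_square|lebesgue. \<phi> p z \<bullet> \<phi> q z)"
    by (simp add: mass_matrix_def)
  note gram = gram_matrix[where g=\<phi>, OF int, folded M]
  have "v = 0" if "v \<bullet> (mass_matrix \<phi> *v v) = 0" for v
    using continuous_on_square_AE_0[OF combination_continuous gram(3)[OF that]]
    by (rule combination_eq_0)
  then show ?thesis
    unfolding spd_def using gram(1,2) by (metis order_le_less)
qed

lemma mean_vector_inner:
  "mean_vector \<phi> \<bullet> v = (LINT z:unit_square|lebesgue. (\<Sum>p\<in>UNIV. v $ p *\<^sub>R \<phi> p z))"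
proof -
  let ?f = "\<lambda>p z. indicator unit_square z *\<^sub>R \<phi> p z"
  have int: "integrable lebesgue (?f p)" for p
    using set_integrable_continuous_on_square[OF basis_continuous] by (simp add: set_integrable_def)
  have "(LINT z:unit_square|lebesgue. (\<Sum>p\<in>UNIV. v $ p *\<^sub>R \<phi> p z))
      = (LINT z|lebesgue. (\<Sum>p\<in>UNIV. v $ p * ?f p z))"
    unfolding set_lebesgue_integral_def
    by (intro Bochner_Integration.integral_cong refl) (simp add: indicator_def)
  also have "\<dots> = (\<Sum>p\<in>UNIV. LINT z|lebesgue. v $ p * ?f p z)"
    by (intro Bochner_Integration.integral_sum integrable_mult_right int)
  also have "\<dots> = (\<Sum>p\<in>UNIV. mean_vector \<phi> $ p * v $ p)"
    by (simp add: mean_vector_def set_lebesgue_integral_def mult.commute)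
  finally show ?thesis by (simp add: inner_vec_def)
qed

text \<open>The stiffness matrix alone has the constants as its kernel. The rank one term adds the square of the
  integral of the function, which vanishes for no constant but zero.\<close>

lemma stabilised_stiffness_spd:
  defines "m \<equiv> mean_vector \<phi>"
  shows "spd (stiffness_matrix \<phi> + (columnvector m :: real^1^'n) ** (rowvector m :: real^'n^1))"
    (is "spd (?K + ?R)")
proof -
  note gram = gram_matrix[where g="\<lambda>p. grad (\<phi> p)", OF P1_grad_inner_integrable[OF basis_P1 basis_P1],
      folded stiffness_matrix_def]
  have R: "?R *v v = (m \<bullet> v) *\<^sub>R m" for v
    by (simp add: vec_eq_iff matrix_vector_mult_def matrix_matrix_mult_def columnvector_def
        rowvector_def inner_vec_def sum_distrib_left mult_ac)
  have q: "v \<bullet> ((?K + ?R) *v v) = v \<bullet> (?K *v v) + (m \<bullet> v)\<^sup>2" for v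
    by (simp add: matrix_vector_mult_add_rdistrib inner_add_right R power2_eq_square inner_commute)
  have ker: "v = 0" if "v \<bullet> (?K *v v) + (m \<bullet> v)\<^sup>2 = 0" for v
  proof -
    define u where "u = (\<lambda>z. \<Sum>p\<in>UNIV. v $ p *\<^sub>R \<phi> p z)"
    have zero: "v \<bullet> (?K *v v) = 0" "m \<bullet> v = 0"
      using that gram(2)[of v] by (smt (verit) zero_le_power2 power2_eq_iff zero_power2 zero_eq_power2)+
    have "u constant_on T" if T: "T \<in> \<T>" for T
    proof -
      have "\<forall>p. \<exists>a b. (\<forall>z\<in>T. \<phi> p z = a \<bullet> z + b) \<and> (\<forall>z\<in>interior T. grad (\<phi> p) z = a)"
        using P1_grad[OF basis_P1 T] by metis
      then obtain a b where ab: "\<And>p z. z \<in> T \<Longrightarrow> \<phi> p z = a p \<bullet> z + b p"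
          "\<And>p z. z \<in> interior T \<Longrightarrow> grad (\<phi> p) z = a p"
        by metis
      \<comment> \<open>One point of the triangle where the combined gradient vanishes is enough, as it is constant there.\<close>
      have "AE z in lebesgue. z \<in> interior T \<longrightarrow> (\<Sum>p\<in>UNIV. v $ p *\<^sub>R grad (\<phi> p) z) = 0"
        using gram(3)[OF zero(1)] by eventually_elim (use mesh_triangle(4)[OF T] in auto)
      from AE_open_witness[OF open_interior mesh_triangle(3)[OF T] this]
      obtain z where "z \<in> interior T" "(\<Sum>p\<in>UNIV. v $ p *\<^sub>R grad (\<phi> p) z) = 0" by blast
      then have a0: "(\<Sum>p\<in>UNIV. v $ p *\<^sub>R a p) = 0" using ab(2) by simp
      have "u y = (\<Sum>p\<in>UNIV. v $ p * b p)" if "y \<in> T" for y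
      proof -
        have "u y = (\<Sum>p\<in>UNIV. v $ p *\<^sub>R a p) \<bullet> y + (\<Sum>p\<in>UNIV. v $ p * b p)"
          using that by (simp add: u_def ab(1) inner_sum_left sum.distrib algebra_simps)
        then show ?thesis by (simp add: a0)
      qed
      then show ?thesis by (auto simp: constant_on_def)
    qed
    moreover have "continuous_on (closure unit_square) u"
      unfolding u_def by (rule combination_continuous)
    ultimately obtain c where c: "\<And>z. z \<in> closure unit_square \<Longrightarrow> u z = c"
      using P1_locally_constant_imp_constant by metis
    have "m \<bullet> v = (LINT z:unit_square|lebesgue. u z)"
      by (simp add: m_def mean_vector_inner u_def)
    also have "\<dots> = (LINT z:unit_square|lebesgue. c)"
      using c closure_subset unit_square_facts(1) by (intro set_lebesgue_integral_cong) auto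
    also have "\<dots> = measure lebesgue unit_square * c"
      by (simp add: set_lebesgue_integral_def)
    finally have "measure lebesgue unit_square * c = 0" using zero by simp
    moreover have "measure lebesgue unit_square \<noteq> 0"
      using unit_square_facts(1-3) open_not_negligible negligible_iff_measure0
        lmeasurable_open bounded_subset compact_imp_bounded closure_subset by metis
    ultimately have "c = 0" by simp
    then show ?thesis using c combination_eq_0 unfolding u_def by blast
  qed
  have sym: "transpose (?K + ?R) = ?K + ?R"
  proof (rule transpose_eqI)
    show "v \<bullet> ((?K + ?R) *v w) = w \<bullet> ((?K + ?R) *v v)" for v w
      using symmetric_matrix_swap[OF gram(1), of v w]
      by (simp add: matrix_vector_mult_add_rdistrib inner_add_right R inner_commute)
  qed
  have "v \<bullet> ((?K + ?R) *v v) \<ge> 0" for v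
    unfolding q using gram(2)[of v] by simp
  then show ?thesis
    unfolding spd_def using sym ker by (metis q order_le_less)
qed

end

end

section \<open>The condition number for the finite element matrices\<close>

theorem corollary5p4:
  fixes \<T> :: "(real \<times> real) set set"
    and x :: "'n::finite \<Rightarrow> real \<times> real"
    and \<phi> :: "'n \<Rightarrow> real \<times> real \<Rightarrow> real"
    and \<eta> :: real
    and M K Kbar Spre :: "real^'n^'n"
    and m :: "real^'n"
    and A Bbdsc :: "real^('n + 'n)^('n + 'n)"
  assumes "is_mesh \<T>" and "node_numbering \<T> x" and "nodal_basis \<T> x \<phi>"
    and "\<eta> > 0"
    and "M = mass_matrix \<phi>" and "K = stiffness_matrix \<phi>" and "m = mean_vector \<phi>"
    and "Kbar = K + (columnvector m :: real^1^'n) ** (rowvector m :: real^'n^1)"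
    and "A = block_matrix Kbar M M (- (\<eta> *\<^sub>R Kbar))"
    and "Spre = \<eta> *\<^sub>R ((Kbar + (\<eta> powr (-1/2)) *\<^sub>R M) ** matrix_inv Kbar
                          ** (Kbar + (\<eta> powr (-1/2)) *\<^sub>R M))"
    and "Bbdsc = block_matrix Kbar 0 0 Spre"
  shows "invertible Kbar \<and> invertible Bbdsc \<and>
         invertible (matrix_inv Bbdsc ** A) \<and>
         eigenvalues (matrix_inv Bbdsc ** A) \<subseteq> \<real> \<and>
         cond_number (matrix_inv Bbdsc ** A) < (sqrt 5 + 1) / (2 * (sqrt 2 - 1))"
proof -
  have M: "spd M"
    using mass_matrix_spd[OF assms(1-3)] assms(5) by simp
  have K: "spd Kbar"
    using stabilised_stiffness_spd[OF assms(1-3)] assms(6-8) by simp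
  show ?thesis
    using spd_invertible[OF K] block_preconditioned_condition_number[OF K M assms(4,10)]
    unfolding assms(9,11) by blast
qed

end
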